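(* Let $\mathcal{X}=\{\mathbf{x}\in\mathbb{Z}^n:\ell_i\le x_i\le u_i\ \forall i\in N\}$ be a discrete hyperrectangle and let $f:\mathcal{X}\to\mathbb{R}$ be L$^\natural$-convex. The Fractional Greedy algorithm (defined in the context) is an exact separation algorithm for the shifted extremal polymatroid inequalities (SEPIs) of $f$, i.e. for an input point $(\hat w,\hat{\mathbf{x}})\in\mathbb{R}\times\overline{\mathcal{X}}$ it returns a SEPI that is most violated at $(\hat w,\hat{\mathbf{x}})$, and it has time complexity $\mathcal{O}(n\log n)$.
   Context: $N=\{1,\dots,n\}$; $\ell_i,u_i\in\mathbb{Z}\cup\{\pm\infty\}$. $\overline{\mathcal{X}}=\{\mathbf{x}\in\mathbb{R}^n:\ell_i\le x_i\le u_i\ \forall i\}$ and $\underline{\mathcal{X}}=\{\mathbf{x}\in\mathbb{Z}^n:\ell_i\le x_i\le u_i-1\ \forall i\}$ (with $\infty-1=\infty$). $f$ is L$^\natural$-convex if $f(\mathbf{x})+f(\mathbf{y})\ge f(\lceil(\mathbf{x}+\mathbf{y})/2\rceil)+f(\lfloor(\mathbf{x}+\mathbf{y})/2\rfloor)$ for all $\mathbf{x},\mathbf{y}\in\mathcal{X}$ (component-wise rounding). For $\mathbf{p}\in\underline{\mathcal{X}}$ and a permutation $\boldsymbol\delta$ of $N$, the SEPI associated with $(\mathbf{p},\boldsymbol\delta)$ is $w\ge R_{\mathbf{p},\boldsymbol\delta}(\mathbf{x})$, where $$R_{\mathbf{p},\boldsymbol\delta}(\mathbf{x})=f(\mathbf{p})+\sum_{i=1}^n\Big[f\Big(\mathbf{p}+\sum_{j=1}^{i}\mathbf{1}^{\delta(j)}\Big)-f\Big(\mathbf{p}+\sum_{j=1}^{i-1}\mathbf{1}^{\delta(j)}\Big)\Big](x_{\delta(i)}-p_{\delta(i)}),$$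 with $\mathbf{1}^i$ the $i$-th unit vector. Its violation at $(\hat w,\hat{\mathbf{x}})$ is $R_{\mathbf{p},\boldsymbol\delta}(\hat{\mathbf{x}})-\hat w$; a most violated SEPI maximizes this quantity over all $\mathbf{p}\in\underline{\mathcal{X}}$ and all permutations $\boldsymbol\delta$ of $N$. Fractional Greedy algorithm: on input $(\hat w,\hat{\mathbf{x}})\in\mathbb{R}\times\overline{\mathcal{X}}$, for each $i\in N$ set $p_i=\hat x_i-1$ if $\hat x_i=u_i$, and $p_i=\lfloor\hat x_i\rfloor$ otherwise; then sort the entries of $\mathbf{r}=\hat{\mathbf{x}}-\mathbf{p}$ to obtain a permutation $\boldsymbol\delta$ with $r_{\delta(1)}\ge r_{\delta(2)}\ge\dots\ge r_{\delta(n)}$; output the SEPI associated with $\mathbf{p}$ and $\boldsymbol\delta$. *)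

theory Defs
  imports
    Complex_Main
    "HOL-Combinatorics.Permutations"
    "HOL-Library.Extended"
    "HOL-Library.Landau_Symbols"
    "HOL-Library.Monad_Syntax"
begin

section \<open>Discrete hyperrectangles and L-natural-convexity\<close>

text \<open>
  The dimension \<open>n\<close> has to vary inside the complexity statement, so a vector of length \<open>n\<close> is a
  function on \<open>nat\<close> that vanishes outside the index set \<open>{1..n}\<close>; this makes the
  representation of a vector unique.
\<close>

definition vecs :: "nat \<Rightarrow> (nat \<Rightarrow> 'a::zero) set" where
  "vecs n = {x. \<forall>i. i \<notin> {1..n} \<longrightarrow> x i = 0}"

definition unit_vec :: "nat \<Rightarrow> nat \<Rightarrow> int" where
  "unit_vec i = (\<lambda>k. if k = i then 1 else 0)"

abbreviation real_bound :: "int extended \<Rightarrow> real extended" where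
  "real_bound \<equiv> map_extended real_of_int"

definition X_int :: "nat \<Rightarrow> (nat \<Rightarrow> int extended) \<Rightarrow> (nat \<Rightarrow> int extended) \<Rightarrow> (nat \<Rightarrow> int) set" where
  "X_int n l u = {x \<in> vecs n. \<forall>i\<in>{1..n}. l i \<le> Fin (x i) \<and> Fin (x i) \<le> u i}"

definition X_over :: "nat \<Rightarrow> (nat \<Rightarrow> int extended) \<Rightarrow> (nat \<Rightarrow> int extended) \<Rightarrow> (nat \<Rightarrow> real) set" where
  "X_over n l u =
     {x \<in> vecs n. \<forall>i\<in>{1..n}. real_bound (l i) \<le> Fin (x i) \<and> Fin (x i) \<le> real_bound (u i)}"

definition X_under :: "nat \<Rightarrow> (nat \<Rightarrow> int extended) \<Rightarrow> (nat \<Rightarrow> int extended) \<Rightarrow> (nat \<Rightarrow> int) set" where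
  "X_under n l u = {x \<in> vecs n. \<forall>i\<in>{1..n}. l i \<le> Fin (x i) \<and> Fin (x i) \<le> u i - 1}"

text \<open>A function on the hyperrectangle is a total function of which only the values on \<open>X_int\<close> matter.\<close>

definition Lnat_convex ::
  "nat \<Rightarrow> (nat \<Rightarrow> int extended) \<Rightarrow> (nat \<Rightarrow> int extended) \<Rightarrow> ((nat \<Rightarrow> int) \<Rightarrow> real) \<Rightarrow> bool" where
  "Lnat_convex n l u f \<longleftrightarrow>
     (\<forall>x\<in>X_int n l u. \<forall>y\<in>X_int n l u.
        f x + f y \<ge> f (\<lambda>i. \<lceil>real_of_int (x i + y i) / 2\<rceil>) + f (\<lambda>i. \<lfloor>real_of_int (x i + y i) / 2\<rfloor>))"

section \<open>Shifted extremal polymatroid inequalities\<close>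

text \<open>The SEPI associated with \<open>(p, \<delta>)\<close> is the inequality \<open>w \<ge> SEPI_rhs n f p \<delta> x\<close> in \<open>(w, x)\<close>.\<close>

definition SEPI_rhs ::
  "nat \<Rightarrow> ((nat \<Rightarrow> int) \<Rightarrow> real) \<Rightarrow> (nat \<Rightarrow> int) \<Rightarrow> (nat \<Rightarrow> nat) \<Rightarrow> (nat \<Rightarrow> real) \<Rightarrow> real" where
  "SEPI_rhs n f p \<delta> x =
     f p + (\<Sum>i=1..n. (f (\<lambda>k. p k + (\<Sum>j=1..i. unit_vec (\<delta> j) k))
                     - f (\<lambda>k. p k + (\<Sum>j=1..i-1. unit_vec (\<delta> j) k)))
                    * (x (\<delta> i) - real_of_int (p (\<delta> i))))"

definition violation ::
  "nat \<Rightarrow> ((nat \<Rightarrow> int) \<Rightarrow> real) \<Rightarrow> real \<Rightarrow> (nat \<Rightarrow> real) \<Rightarrow> (nat \<Rightarrow> int) \<times> (nat \<Rightarrow> nat) \<Rightarrow> real" where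
  "violation n f w x = (\<lambda>(p, \<delta>). SEPI_rhs n f p \<delta> x - w)"

definition SEPI_index ::
  "nat \<Rightarrow> (nat \<Rightarrow> int extended) \<Rightarrow> (nat \<Rightarrow> int extended) \<Rightarrow> ((nat \<Rightarrow> int) \<times> (nat \<Rightarrow> nat)) set" where
  "SEPI_index n l u = X_under n l u \<times> {\<delta>. \<delta> permutes {1..n}}"

definition most_violated ::
  "nat \<Rightarrow> (nat \<Rightarrow> int extended) \<Rightarrow> (nat \<Rightarrow> int extended) \<Rightarrow> ((nat \<Rightarrow> int) \<Rightarrow> real)
     \<Rightarrow> real \<Rightarrow> (nat \<Rightarrow> real) \<Rightarrow> (nat \<Rightarrow> int) \<times> (nat \<Rightarrow> nat) \<Rightarrow> bool" where
  "most_violated n l u f w x = is_arg_max (violation n f w x) (\<lambda>s. s \<in> SEPI_index n l u)"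

section \<open>The Fractional Greedy algorithm as an input-output relation\<close>

text \<open>
  The algorithm does not say how ties in \<open>r = x - p\<close> are broken, so it admits every sorting
  permutation.
\<close>

definition fractional_greedy_output ::
  "nat \<Rightarrow> (nat \<Rightarrow> int extended) \<Rightarrow> (nat \<Rightarrow> real) \<Rightarrow> (nat \<Rightarrow> int) \<times> (nat \<Rightarrow> nat) \<Rightarrow> bool" where
  "fractional_greedy_output n u x = (\<lambda>(p, \<delta>).
     p \<in> vecs n \<and>
     (\<forall>i\<in>{1..n}. if Fin (x i) = real_bound (u i) then real_of_int (p i) = x i - 1
                  else p i = \<lfloor>x i\<rfloor>) \<and>
     \<delta> permutes {1..n} \<and>
     (\<forall>i\<in>{1..n}. \<forall>j\<in>{1..n}. i \<le> j \<longrightarrow>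
        x (\<delta> i) - real_of_int (p (\<delta> i)) \<ge> x (\<delta> j) - real_of_int (p (\<delta> j))))"

section \<open>The Fractional Greedy algorithm as a program with a step count\<close>

text \<open>
  The cost model is a unit-cost random access machine on reals and integers with a value oracle for
  \<open>f\<close>. A computation returns its result together with the number of steps it has taken. A step is
  one array read or write, one arithmetic operation, comparison or rounding, one list construction,
  one oracle call, or the end of a loop. Loop counters and index arithmetic carry no charge of their
  own; every iteration and every recursive call takes at least one step.

  Arrays are functions on indices. The program below uses each array that it writes to linearly (an
  old version is never accessed after a write), so that each write stands for one in-place update,
  and the oracle is called on the array that currently holds the query point. Creating an array, be
  it by initialization or by copying, costs one step per cell.
\<close>

type_synonym 'a timed = "'a \<times> nat"

definition result :: "'a timed \<Rightarrow> 'a" where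
  "result m = fst m"

definition steps :: "'a timed \<Rightarrow> nat" where
  "steps m = snd m"

definition bind_timed :: "'a timed \<Rightarrow> ('a \<Rightarrow> 'b timed) \<Rightarrow> 'b timed" where
  "bind_timed m g = (case m of (v, s) \<Rightarrow> case g v of (v', t) \<Rightarrow> (v', s + t))"

adhoc_overloading Monad_Syntax.bind \<rightleftharpoons> bind_timed

definition ret :: "'a \<Rightarrow> 'a timed" where
  "ret v = (v, 0)"

definition step :: "'a \<Rightarrow> 'a timed" where
  "step v = (v, 1)"

definition rd :: "(nat \<Rightarrow> 'a) \<Rightarrow> nat \<Rightarrow> 'a timed" where
  "rd a i = step (a i)"

definition wr :: "(nat \<Rightarrow> 'a) \<Rightarrow> nat \<Rightarrow> 'a \<Rightarrow> (nat \<Rightarrow> 'a) timed" where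
  "wr a i v = step (a(i := v))"

definition new_array :: "nat \<Rightarrow> (nat \<Rightarrow> 'a) \<Rightarrow> (nat \<Rightarrow> 'a) timed" where
  "new_array n a = (a, n + 1)"

text \<open>Computes \<open>p\<close> and \<open>r = x - p\<close> at the indices \<open>k, \<dots>, 1\<close>.\<close>

fun round_loop ::
  "(nat \<Rightarrow> int extended) \<Rightarrow> (nat \<Rightarrow> real) \<Rightarrow> nat \<Rightarrow> (nat \<Rightarrow> int) \<Rightarrow> (nat \<Rightarrow> real)
     \<Rightarrow> ((nat \<Rightarrow> int) \<times> (nat \<Rightarrow> real)) timed" where
  "round_loop u x 0 p r = step (p, r)"
| "round_loop u x (Suc k) p r = do {
     xk \<leftarrow> rd x (Suc k);
     uk \<leftarrow> rd u (Suc k);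
     tight \<leftarrow> step (Fin xk = real_bound uk);
     fl \<leftarrow> step \<lfloor>xk\<rfloor>;
     pk \<leftarrow> (if tight then step (fl - 1) else ret fl);
     rk \<leftarrow> step (xk - real_of_int pk);
     p' \<leftarrow> wr p (Suc k) pk;
     r' \<leftarrow> wr r (Suc k) rk;
     round_loop u x k p' r'
   }"

fun merge :: "(nat \<Rightarrow> real) \<Rightarrow> nat list \<Rightarrow> nat list \<Rightarrow> nat list timed" where
  "merge r [] ys = step ys"
| "merge r (i # xs) [] = step (i # xs)"
| "merge r (i # xs) (j # ys) = do {
     a \<leftarrow> rd r i;
     b \<leftarrow> rd r j;
     c \<leftarrow> step (a \<ge> b);
     if c then do { zs \<leftarrow> merge r xs (j # ys); step (i # zs) }
     else do { zs \<leftarrow> merge r (i # xs) ys; step (j # zs) }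
   }"

text \<open>Merge sort of the \<open>k\<close> indices \<open>i, \<dots>, i + k - 1\<close> by non-increasing key \<open>r\<close>.\<close>

fun merge_sort :: "(nat \<Rightarrow> real) \<Rightarrow> nat \<Rightarrow> nat \<Rightarrow> nat list timed" where
  "merge_sort r i k =
     (if k = 0 then step []
      else if k = 1 then step [i]
      else do {
        xs \<leftarrow> merge_sort r i (k div 2);
        ys \<leftarrow> merge_sort r (i + k div 2) (k - k div 2);
        merge r xs ys
      })"

declare merge_sort.simps [simp del]

fun store_list :: "nat list \<Rightarrow> nat \<Rightarrow> (nat \<Rightarrow> nat) \<Rightarrow> (nat \<Rightarrow> nat) timed" where
  "store_list [] i d = step d"
| "store_list (x # xs) i d = do { d' \<leftarrow> wr d i x; store_list xs (Suc i) d' }"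

text \<open>
  Computes the coefficients \<open>a\<close> and the constant \<open>b\<close> of the affine function
  \<open>SEPI_rhs n f p \<delta>\<close>. The array \<open>q\<close> runs through the points \<open>p + \<Sum>j\<le>i. unit_vec (\<delta> j)\<close>, and \<open>v\<close>
  is the value of \<open>f\<close> at the current one. The entry of \<open>q\<close> that is read is still equal to that
  of \<open>p\<close>, since each coordinate is increased only once.
\<close>

fun coeff_loop ::
  "((nat \<Rightarrow> int) \<Rightarrow> real) \<Rightarrow> (nat \<Rightarrow> nat) \<Rightarrow> nat \<Rightarrow> nat \<Rightarrow> (nat \<Rightarrow> int) \<Rightarrow> real
     \<Rightarrow> (nat \<Rightarrow> real) \<Rightarrow> real \<Rightarrow> ((nat \<Rightarrow> real) \<times> real) timed" where
  "coeff_loop f d 0 i q v a b = step (a, b)"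
| "coeff_loop f d (Suc k) i q v a b = do {
     j \<leftarrow> rd d i;
     qj \<leftarrow> rd q j;
     qj' \<leftarrow> step (qj + 1);
     q' \<leftarrow> wr q j qj';
     v' \<leftarrow> step (f q');
     s \<leftarrow> step (v' - v);
     a' \<leftarrow> wr a j s;
     t \<leftarrow> step (s * real_of_int qj);
     b' \<leftarrow> step (b - t);
     coeff_loop f d k (Suc i) q' v' a' b'
   }"

text \<open>
  The output consists of \<open>p\<close>, \<open>\<delta>\<close> and the explicit inequality \<open>w \<ge> b + (\<Sum>i=1..n. a i * x i)\<close>.
  Only the cells \<open>1, \<dots>, n\<close> of an array are memory. Initializing \<open>d\<close> with the identity makes its
  final value a permutation in the sense of \<open>permutes\<close>.
\<close>

definition fractional_greedy ::
  "nat \<Rightarrow> (nat \<Rightarrow> int extended) \<Rightarrow> ((nat \<Rightarrow> int) \<Rightarrow> real) \<Rightarrow> real \<times> (nat \<Rightarrow> real)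
     \<Rightarrow> ((nat \<Rightarrow> int) \<times> (nat \<Rightarrow> nat) \<times> (nat \<Rightarrow> real) \<times> real) timed" where
  "fractional_greedy n u f = (\<lambda>(w, x). do {
     p0 \<leftarrow> new_array n (\<lambda>_. 0);
     r0 \<leftarrow> new_array n (\<lambda>_. 0);
     (p, r) \<leftarrow> round_loop u x n p0 r0;
     ds \<leftarrow> merge_sort r 1 n;
     d0 \<leftarrow> new_array n (\<lambda>i. i);
     d \<leftarrow> store_list ds 1 d0;
     q \<leftarrow> new_array n p;
     v \<leftarrow> step (f q);
     a0 \<leftarrow> new_array n (\<lambda>_. 0);
     (a, b) \<leftarrow> coeff_loop f d n 1 q v a0 v;
     ret (p, d, a, b)
   })"

end

theory Submission
  imports Defs "HOL-Real_Asymp.Real_Asymp"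
begin

text \<open>
  Subtracting the affine right-hand side of a SEPI from \<open>f\<close> leaves an L-natural-convex function that
  vanishes on the chain of the SEPI; midpoint convexity then forces it to be nonnegative on the
  whole hyperrectangle, so every SEPI is valid at the integer points. The greedy choice writes the
  input point as a convex combination of the chain of its own SEPI, where that SEPI is tight, and
  hence no other SEPI is more violated.
\<close>

section \<open>Midpoint convexity on the hyperrectangle\<close>

lemma ceiling_half: "\<lceil>real_of_int z / 2\<rceil> = (z + 1) div 2"
  by linarith

lemma floor_half: "\<lfloor>real_of_int z / 2\<rfloor> = z div 2"
  by linarith

lemma Lnat_convexD:
  assumes "Lnat_convex n l u f" "x \<in> X_int n l u" "y \<in> X_int n l u"
  shows "f (\<lambda>i. (x i + y i + 1) div 2) + f (\<lambda>i. (x i + y i) div 2) \<le> f x + f y"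
  using assms unfolding Lnat_convex_def ceiling_half floor_half by blast

lemma extended_between:
  assumes "l \<le> Fin a \<and> Fin a \<le> u" "l \<le> Fin b \<and> Fin b \<le> u" "min a b \<le> c" "c \<le> max a b"
  shows "l \<le> Fin (c :: int) \<and> Fin c \<le> u"
  using assms by (cases l; cases u) auto

lemma X_int_between:
  assumes "x \<in> X_int n l u" "y \<in> X_int n l u"
    and "\<And>i. min (x i) (y i) \<le> z i" "\<And>i. z i \<le> max (x i) (y i)"
  shows "z \<in> X_int n l u"
proof -
  have "z i = 0" if "i \<notin> {1..n}" for i
    using assms(1,2) assms(3)[of i] assms(4)[of i] that by (simp add: X_int_def vecs_def)
  moreover have "l i \<le> Fin (z i) \<and> Fin (z i) \<le> u i" if "i \<in> {1..n}" for i
    using assms(1,2) that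
    by (intro extended_between[OF _ _ assms(3,4)]) (auto simp: X_int_def)
  ultimately show ?thesis by (auto simp: X_int_def vecs_def)
qed

lemma X_int_midpoints:
  assumes "x \<in> X_int n l u" "y \<in> X_int n l u"
  shows "(\<lambda>i. (x i + y i + 1) div 2) \<in> X_int n l u" "(\<lambda>i. (x i + y i) div 2) \<in> X_int n l u"
  by (rule X_int_between[OF assms]; linarith)+

text \<open>The rounded-up and rounded-down midpoints of \<open>x\<close> and \<open>y\<close> add
  up to \<open>x + y\<close>, so an affine function meets the midpoint inequality with equality and
  subtracting it changes nothing.\<close>

lemma Lnat_convex_minus_affine:
  assumes "Lnat_convex n l u f"
  shows "Lnat_convex n l u (\<lambda>y. f y - (c + (\<Sum>k=1..n. A k * real_of_int (y k))))"
  unfolding Lnat_convex_def ceiling_half floor_half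
proof (intro ballI)
  fix x y assume xy: "x \<in> X_int n l u" "y \<in> X_int n l u"
  have "real_of_int ((x k + y k + 1) div 2) + real_of_int ((x k + y k) div 2)
      = real_of_int (x k) + real_of_int (y k)" for k
  proof -
    have "(x k + y k + 1) div 2 + (x k + y k) div 2 = x k + y k" by linarith
    then show ?thesis by (metis of_int_add)
  qed
  then have "(\<Sum>k=1..n. A k * real_of_int ((x k + y k + 1) div 2))
      + (\<Sum>k=1..n. A k * real_of_int ((x k + y k) div 2))
      = (\<Sum>k=1..n. A k * real_of_int (x k)) + (\<Sum>k=1..n. A k * real_of_int (y k))"
    by (simp add: sum.distrib [symmetric] distrib_left [symmetric])
  then show "f (\<lambda>i. (x i + y i + 1) div 2)
        - (c + (\<Sum>k=1..n. A k * real_of_int ((x k + y k + 1) div 2)))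
      + (f (\<lambda>i. (x i + y i) div 2) - (c + (\<Sum>k=1..n. A k * real_of_int ((x k + y k) div 2))))
      \<le> f x - (c + (\<Sum>k=1..n. A k * real_of_int (x k)))
        + (f y - (c + (\<Sum>k=1..n. A k * real_of_int (y k))))"
    using Lnat_convexD[OF assms xy] by linarith
qed

section \<open>The unit cube at a point and the chain of a permutation\<close>

definition shift :: "(nat \<Rightarrow> int) \<Rightarrow> nat set \<Rightarrow> nat \<Rightarrow> int" where
  "shift p A = (\<lambda>k. p k + of_bool (k \<in> A))"

lemma shift_empty [simp]: "shift p {} = p"
  by (simp add: shift_def)

text \<open>For 0/1-displacements, rounding the average up gives the union of the supports and
  rounding it down the intersection. Here \<open>A \<union> S = insert k S\<close> and
  \<open>A \<inter> S = A - {k}\<close>, so midpoint convexity acts as submodularity on the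
  cube.\<close>

lemma shift_midpoints:
  assumes "k \<in> A" "k \<notin> S" "A \<subseteq> insert k S"
  shows "(\<lambda>i. (shift p A i + shift p S i + 1) div 2) = shift p (insert k S)"
    and "(\<lambda>i. (shift p A i + shift p S i) div 2) = shift p (A - {k})"
  using assms by (auto simp: shift_def fun_eq_iff)

text \<open>The upper bound \<open>u i - 1\<close> in \<open>X_under\<close> leaves room for one
  unit step in every coordinate.\<close>

lemma shift_in_X_int:
  assumes "p \<in> X_under n l u" "A \<subseteq> {1..n}"
  shows "shift p A \<in> X_int n l u"
proof -
  have "l i \<le> Fin (p i + of_bool (i \<in> A)) \<and> Fin (p i + of_bool (i \<in> A)) \<le> u i"
    if "i \<in> {1..n}" for i
  proof -
    have "l i \<le> Fin (p i) \<and> Fin (p i) \<le> u i - 1"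
      using assms(1) that by (auto simp: X_under_def)
    then show ?thesis
      by (cases "l i"; cases "u i") (auto simp: one_extended_def)
  qed
  then show ?thesis
    using assms by (auto simp: X_int_def X_under_def vecs_def shift_def)
qed

lemma permutes_image_atMost_Suc:
  assumes "\<delta> permutes {1..n}"
  shows "\<delta> ` {1..Suc m} = insert (\<delta> (Suc m)) (\<delta> ` {1..m})" "\<delta> (Suc m) \<notin> \<delta> ` {1..m}"
proof -
  show "\<delta> ` {1..Suc m} = insert (\<delta> (Suc m)) (\<delta> ` {1..m})"
    by (simp add: atLeastAtMostSuc_conv)
  show "\<delta> (Suc m) \<notin> \<delta> ` {1..m}"
    using permutes_inj[OF assms] by (simp add: inj_image_mem_iff)
qed

lemma permutes_image_initial_subset:
  fixes n :: nat
  assumes "\<delta> permutes {1..n}" "m \<le> n"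
  shows "\<delta> ` {1..m} \<subseteq> {1..n}"
proof -
  have "{1..m} \<subseteq> {1..n}" using assms(2) by simp
  then have "\<delta> ` {1..m} \<subseteq> \<delta> ` {1..n}" by (rule image_mono)
  then show ?thesis unfolding permutes_image[OF assms(1)] .
qed

text \<open>Remove the elements of \<open>A\<close> in reverse chain order. If \<open>A\<close>
  contains the newest element \<open>k\<close> of the chain, the midpoints of \<open>A\<close> and
  the preceding chain set \<open>S\<close> are the next chain set and \<open>A - {k}\<close>. As
  \<open>g\<close> vanishes on the chain, \<open>g\<close> at \<open>A\<close> is at least
  \<open>g\<close> at \<open>A - {k}\<close>.\<close>

lemma Lnat_convex_nonneg_on_cube:
  assumes g: "Lnat_convex n l u g" and p: "p \<in> X_under n l u" and d: "\<delta> permutes {1..n}"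
    and chain: "\<And>i. i \<le> n \<Longrightarrow> g (shift p (\<delta> ` {1..i})) = 0"
  shows "m \<le> n \<Longrightarrow> A \<subseteq> \<delta> ` {1..m} \<Longrightarrow> g (shift p A) \<ge> 0"
proof (induction m arbitrary: A)
  case 0
  then show ?case using chain[of 0] by simp
next
  case (Suc m)
  let ?k = "\<delta> (Suc m)" and ?S = "\<delta> ` {1..m}"
  note img = permutes_image_atMost_Suc[OF d, of m]
  show ?case
  proof (cases "?k \<in> A")
    case False
    then show ?thesis using Suc img by (intro Suc.IH) auto
  next
    case True
    have sub: "?S \<subseteq> {1..n}" "A \<subseteq> {1..n}"
      using permutes_image_initial_subset[OF d, of m] permutes_image_initial_subset[OF d Suc.prems(1)] Suc.prems
      by auto
    have "A \<subseteq> insert ?k ?S" using Suc.prems img by simp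
    then have up: "(\<lambda>i. (shift p A i + shift p ?S i + 1) div 2) = shift p (\<delta> ` {1..Suc m})"
      and down: "(\<lambda>i. (shift p A i + shift p ?S i) div 2) = shift p (A - {?k})"
      using shift_midpoints[OF True img(2)] img(1) by simp_all
    have "g (shift p (\<delta> ` {1..Suc m})) + g (shift p (A - {?k})) \<le> g (shift p A) + g (shift p ?S)"
      using Lnat_convexD[OF g shift_in_X_int[OF p sub(2)] shift_in_X_int[OF p sub(1)]]
      unfolding up down .
    moreover have "g (shift p (A - {?k})) \<ge> 0"
      using Suc.prems img by (intro Suc.IH) auto
    ultimately show ?thesis using chain[of m] chain[OF Suc.prems(1)] Suc.prems(1) by simp
  qed
qed

text \<open>
  Halving the displacement from \<open>p\<close> makes it smaller unless it is a 0/1-vector or a 0/-1-vector.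
  The latter is moved into the unit cube at \<open>p\<close> by halving towards \<open>p + (1, \<dots>, 1)\<close>.
\<close>

lemma Lnat_convex_nonneg:
  assumes g: "Lnat_convex n l u g" and p: "p \<in> X_under n l u" and d: "\<delta> permutes {1..n}"
    and chain: "\<And>i. i \<le> n \<Longrightarrow> g (shift p (\<delta> ` {1..i})) = 0"
  shows "y \<in> X_int n l u \<Longrightarrow> g y \<ge> 0"
proof (induction "\<Sum>i=1..n. nat \<bar>y i - p i\<bar>" arbitrary: y rule: less_induct)
  case less
  have cube: "g (shift p A) \<ge> 0" if "A \<subseteq> {1..n}" for A
    using Lnat_convex_nonneg_on_cube[OF g p d chain order.refl] that permutes_image[OF d] by simp
  have pX: "p \<in> X_int n l u" and p1X: "shift p {1..n} \<in> X_int n l u"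
    using shift_in_X_int[OF p, of "{}"] shift_in_X_int[OF p, of "{1..n}"] by simp_all
  have gp: "g p = 0" and gp1: "g (shift p {1..n}) = 0"
    using chain[of 0] chain[of n] permutes_image[OF d] by simp_all
  have outside: "y i = 0" "p i = 0" if "i \<notin> {1..n}" for i
    using less.prems p that by (auto simp: X_int_def X_under_def vecs_def)
  consider "\<forall>i\<in>{1..n}. y i - p i \<in> {0, 1}" | "\<forall>i\<in>{1..n}. y i - p i \<in> {0, -1}"
    | i j where "i \<in> {1..n}" "y i - p i \<notin> {0, 1}" "j \<in> {1..n}" "y j - p j \<notin> {0, -1}"
    by blast
  then show ?case
  proof cases
    case 1
    then have "y = shift p {i \<in> {1..n}. y i = p i + 1}"
      using outside by (fastforce simp: shift_def fun_eq_iff)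
    then show ?thesis using cube[of "{i \<in> {1..n}. y i = p i + 1}"] by (metis (lifting) mem_Collect_eq subsetI)
  next
    case 2
    \<comment> \<open>Averaging a displacement 0 or -1 with 1 rounds down to 0 in both cases, which
      gives \<open>p\<close>, where \<open>g\<close> vanishes. It rounds up to 1 or 0, which gives a
      cube point.\<close>
    have "(y i + shift p {1..n} i + 1) div 2 = shift p {i \<in> {1..n}. y i = p i} i
        \<and> (y i + shift p {1..n} i) div 2 = p i" for i
    proof (cases "i \<in> {1..n}")
      case True
      then have "y i = p i \<or> y i = p i - 1" using 2 by fastforce
      then show ?thesis using True by (auto simp: shift_def)
    next
      case False
      then show ?thesis using outside by (simp add: shift_def)
    qed
    then have "g (shift p {i \<in> {1..n}. y i = p i}) + g p \<le> g y + g (shift p {1..n})"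
      using Lnat_convexD[OF g less.prems p1X] by simp
    moreover have "g (shift p {i \<in> {1..n}. y i = p i}) \<ge> 0" by (intro cube) auto
    ultimately show ?thesis using gp gp1 by linarith
  next
    case 3
    \<comment> \<open>A displacement \<open>t\<close> becomes \<open>(t + 1) div 2\<close> or
      \<open>t div 2\<close>. The first fixes 0 and 1, the second fixes 0 and -1, and each brings
      every other value closer to 0. Hence \<open>i\<close> makes the l1-distance drop for the upper
      midpoint and \<open>j\<close> for the lower one.\<close>
    note X = X_int_midpoints[OF less.prems pX]
    have "(\<Sum>i=1..n. nat \<bar>(y i + p i + 1) div 2 - p i\<bar>) < (\<Sum>i=1..n. nat \<bar>y i - p i\<bar>)"
      using 3(1,2) by (intro sum_strict_mono_ex1 ballI bexI[of _ i]) (auto; linarith)+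
    then have up: "g (\<lambda>i. (y i + p i + 1) div 2) \<ge> 0" by (rule less.hyps) (rule X(1))
    have "(\<Sum>i=1..n. nat \<bar>(y i + p i) div 2 - p i\<bar>) < (\<Sum>i=1..n. nat \<bar>y i - p i\<bar>)"
      using 3(3,4) by (intro sum_strict_mono_ex1 ballI bexI[of _ j]) (auto; linarith)+
    then have "g (\<lambda>i. (y i + p i) div 2) \<ge> 0" by (rule less.hyps) (rule X(2))
    with up show ?thesis using Lnat_convexD[OF g less.prems pX] gp by linarith
  qed
qed

section \<open>Optimality of the greedy inequality\<close>

lemma sum_unit_vec:
  assumes "\<delta> permutes {1..n}"
  shows "(\<lambda>k. p k + (\<Sum>j=1..i. unit_vec (\<delta> j) k)) = shift p (\<delta> ` {1..i})"
proof (induction i)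
  case 0
  then show ?case by simp
next
  case (Suc i)
  then show ?case
    using permutes_image_atMost_Suc[OF assms, of i]
    by (auto simp: shift_def unit_vec_def fun_eq_iff)
qed

lemma SEPI_rhs_shift:
  assumes "\<delta> permutes {1..n}"
  shows "SEPI_rhs n f p \<delta> x = f p + (\<Sum>i=1..n. (f (shift p (\<delta> ` {1..i}))
           - f (shift p (\<delta> ` {1..i-1}))) * (x (\<delta> i) - real_of_int (p (\<delta> i))))"
  unfolding SEPI_rhs_def sum_unit_vec[OF assms] ..

text \<open>Reindexing by \<open>inv \<delta>\<close> collects the coefficients by coordinate. In
  this form a SEPI can be subtracted from \<open>f\<close>, and it can be evaluated along the chain
  of a different SEPI.\<close>

lemma SEPI_rhs_affine:
  assumes "\<delta> permutes {1..n}"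
  obtains A c where "\<And>y. SEPI_rhs n f p \<delta> y = c + (\<Sum>k=1..n. A k * y k)"
proof -
  define F where "F i = f (shift p (\<delta> ` {1..i})) - f (shift p (\<delta> ` {1..i-1}))" for i
  define A where "A k = F (inv \<delta> k)" for k
  have "SEPI_rhs n f p \<delta> y = f p - (\<Sum>i=1..n. F i * real_of_int (p (\<delta> i))) + (\<Sum>k=1..n. A k * y k)"
    for y
  proof -
    have "(\<Sum>k=1..n. A k * y k) = (\<Sum>i=1..n. A (\<delta> i) * y (\<delta> i))"
      using sum.permute[OF assms, of "\<lambda>k. A k * y k"] by (simp add: o_def)
    also have "\<dots> = (\<Sum>i=1..n. F i * y (\<delta> i))"
      by (simp add: A_def permutes_inverses(2)[OF assms])
    finally show ?thesis
      unfolding SEPI_rhs_shift[OF assms] F_def by (simp add: sum_subtractf right_diff_distrib)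
  qed
  then show ?thesis by (rule that)
qed

text \<open>At the \<open>m\<close>-th chain point the first \<open>m\<close> factors are 1 and the
  others 0, so the sum telescopes. This is the tightness of a SEPI on its own chain.\<close>

lemma SEPI_rhs_chain:
  assumes "\<delta> permutes {1..n}" "m \<le> n"
  shows "SEPI_rhs n f p \<delta> (\<lambda>k. real_of_int (shift p (\<delta> ` {1..m}) k)) = f (shift p (\<delta> ` {1..m}))"
proof -
  define F where "F i = f (shift p (\<delta> ` {1..i}))" for i
  have "real_of_int (shift p (\<delta> ` {1..m}) (\<delta> i)) - real_of_int (p (\<delta> i)) = of_bool (i \<in> {1..m})" for i
    using inj_image_mem_iff[OF permutes_inj[OF assms(1)], of i "{1..m}"] by (simp add: shift_def)
  then have "SEPI_rhs n f p \<delta> (\<lambda>k. real_of_int (shift p (\<delta> ` {1..m}) k))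
      = f p + (\<Sum>i=1..n. (F i - F (i-1)) * of_bool (i \<in> {1..m}))"
    unfolding SEPI_rhs_shift[OF assms(1)] F_def by simp
  also have "(\<Sum>i=1..n. (F i - F (i-1)) * of_bool (i \<in> {1..m})) = (\<Sum>i=1..m. F i - F (i-1))"
    using assms(2) by (intro sum.mono_neutral_cong_right) auto
  also have "\<dots> = F m - F 0"
    by (induction m) auto
  finally show ?thesis by (simp add: F_def)
qed

lemma SEPI_valid:
  assumes f: "Lnat_convex n l u f" and p: "p \<in> X_under n l u" and d: "\<delta> permutes {1..n}"
    and y: "y \<in> X_int n l u"
  shows "SEPI_rhs n f p \<delta> (\<lambda>k. real_of_int (y k)) \<le> f y"
proof -
  obtain A c where R: "\<And>y. SEPI_rhs n f p \<delta> y = c + (\<Sum>k=1..n. A k * y k)"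
    using SEPI_rhs_affine[OF d] by metis
  define g where "g y = f y - (c + (\<Sum>k=1..n. A k * real_of_int (y k)))" for y
  have "Lnat_convex n l u g"
    unfolding g_def by (rule Lnat_convex_minus_affine[OF f])
  moreover have "g (shift p (\<delta> ` {1..i})) = 0" if "i \<le> n" for i
    using SEPI_rhs_chain[OF d that, of f p] by (simp add: g_def R)
  ultimately have "g y \<ge> 0" by (intro Lnat_convex_nonneg[OF _ p d _ y])
  then show ?thesis by (simp add: g_def R)
qed

text \<open>With \<open>r 0 = 1\<close>, summation by parts turns the expression into the sum of
  \<open>D i * (r i - r (i + 1))\<close> over \<open>i < n\<close> plus \<open>D n * r n\<close>.
  These nonnegative factors are the weights of the greedy convex combination.\<close>

lemma Abel_sum_nonneg:
  fixes D r :: "nat \<Rightarrow> real"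
  assumes "\<And>i. i \<le> n \<Longrightarrow> D i \<ge> 0" "\<And>i. i \<in> {1..n} \<Longrightarrow> 0 \<le> r i \<and> r i \<le> 1"
    and "\<And>i j. 1 \<le> i \<Longrightarrow> i \<le> j \<Longrightarrow> j \<le> n \<Longrightarrow> r j \<le> r i"
  shows "D 0 + (\<Sum>i=1..n. (D i - D (i-1)) * r i) \<ge> 0"
proof -
  \<comment> \<open>The value 1 at index 0 gives \<open>D 0\<close> a weight of the same form as the
    others; the partial sums up to \<open>m\<close> then stay above
    \<open>D m * r' m\<close>.\<close>
  define r' where "r' i = (if i = 0 then 1 else r i)" for i
  have step: "r' (Suc m) \<le> r' m" if "Suc m \<le> n" for m
    using assms(2)[of "Suc m"] assms(3)[of m "Suc m"] that by (auto simp: r'_def)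
  have "D 0 + (\<Sum>i=1..m. (D i - D (i-1)) * r i) \<ge> D m * r' m" if "m \<le> n" for m
    using that
  proof (induction m)
    case 0
    then show ?case by (simp add: r'_def)
  next
    case (Suc m)
    have "D m * r' (Suc m) \<le> D m * r' m"
      using assms(1)[of m] step Suc.prems by (intro mult_left_mono) auto
    then show ?case using Suc by (simp add: r'_def algebra_simps)
  qed
  from this[of n] have "D n * r' n \<le> D 0 + (\<Sum>i=1..n. (D i - D (i-1)) * r i)" by simp
  moreover have "D n * r' n \<ge> 0"
    using assms(1)[of n] assms(2)[of n] by (auto simp: r'_def)
  ultimately show ?thesis by linarith
qed

text \<open>A point of \<open>X_under\<close> certifies that \<open>u i - 1\<close> is not below
  \<open>l i\<close>, so stepping down from a tight \<open>x i\<close> stays in the box. If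
  \<open>x i\<close> is not tight, its floor is at most \<open>u i - 1\<close>, and it is at least
  \<open>l i\<close> because \<open>l i\<close> is integral or infinite.\<close>

lemma fractional_greedy_output_in_X_under:
  assumes "fractional_greedy_output n u x (p, \<delta>)" "x \<in> X_over n l u" "X_under n l u \<noteq> {}"
  shows "p \<in> X_under n l u"
proof -
  obtain z where z: "z \<in> X_under n l u" using assms(3) by auto
  have "l i \<le> Fin (p i) \<and> Fin (p i) \<le> u i - 1" if i: "i \<in> {1..n}" for i
  proof -
    have "real_bound (l i) \<le> Fin (x i)" "Fin (x i) \<le> real_bound (u i)"
      using assms(2) i by (auto simp: X_over_def)
    moreover have "l i \<le> Fin (z i)" "Fin (z i) \<le> u i - 1"
      using z i by (auto simp: X_under_def)
    moreover have "if Fin (x i) = real_bound (u i) then real_of_int (p i) = x i - 1 else p i = \<lfloor>x i\<rfloor>"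
      using assms(1) i by (auto simp: fractional_greedy_output_def)
    ultimately show ?thesis
      by (cases "l i"; cases "u i") (auto simp: one_extended_def le_floor_iff split: if_splits; linarith)+
  qed
  then show ?thesis
    using assms(1) by (auto simp: X_under_def fractional_greedy_output_def)
qed

lemma fractional_greedy_output_most_violated:
  assumes f: "Lnat_convex n l u f" and x: "x \<in> X_over n l u" and ne: "X_under n l u \<noteq> {}"
    and out: "fractional_greedy_output n u x s"
  shows "most_violated n l u f w x s"
proof -
  obtain p \<delta> where s: "s = (p, \<delta>)" by force
  have p: "p \<in> X_under n l u" and d: "\<delta> permutes {1..n}"
    using fractional_greedy_output_in_X_under[OF _ x ne] out
    by (auto simp: s fractional_greedy_output_def)
  define r where "r i = x (\<delta> i) - real_of_int (p (\<delta> i))" for i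
  \<comment> \<open>The value is 1 at a tight coordinate and the fractional part of
    \<open>x (\<delta> i)\<close> at any other.\<close>
  have r01: "0 \<le> r i \<and> r i \<le> 1" if "i \<in> {1..n}" for i
  proof -
    have "\<delta> i \<in> {1..n}" using permutes_in_image[OF d] that by blast
    then have "if Fin (x (\<delta> i)) = real_bound (u (\<delta> i)) then real_of_int (p (\<delta> i)) = x (\<delta> i) - 1
        else p (\<delta> i) = \<lfloor>x (\<delta> i)\<rfloor>"
      using out by (auto simp: s fractional_greedy_output_def)
    then show ?thesis by (auto simp: r_def split: if_splits; linarith)
  qed
  have rmono: "r j \<le> r i" if "1 \<le> i" "i \<le> j" "j \<le> n" for i j
    using out that by (auto simp: s fractional_greedy_output_def r_def)
  have "SEPI_rhs n f p' \<delta>' x \<le> SEPI_rhs n f p \<delta> x"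
    if p': "p' \<in> X_under n l u" and d': "\<delta>' permutes {1..n}" for p' \<delta>'
  proof -
    obtain A c where R: "\<And>y. SEPI_rhs n f p' \<delta>' y = c + (\<Sum>k=1..n. A k * y k)"
      using SEPI_rhs_affine[OF d'] by metis
    \<comment> \<open>The competing SEPI is sampled along the greedy chain \<open>q\<close>:
      \<open>G\<close> holds its values there and \<open>D\<close> its gap below \<open>f\<close>,
      which is nonnegative by validity. Expanding both right-hand sides from \<open>p = q 0\<close>
      with the same factors \<open>r i\<close> makes their difference at \<open>x\<close> an Abel
      sum of \<open>D\<close>.\<close>
    define q where "q i = shift p (\<delta> ` {1..i})" for i
    define G where "G i = SEPI_rhs n f p' \<delta>' (\<lambda>k. real_of_int (q i k))" for i
    define D where "D i = f (q i) - G i" for i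
    have q0: "q 0 = p" by (simp add: q_def)
    have D: "D i \<ge> 0" if "i \<le> n" for i
      using SEPI_valid[OF f p' d' shift_in_X_int[OF p permutes_image_initial_subset[OF d that]]]
      by (simp add: D_def G_def q_def)
    \<comment> \<open>Consecutive chain points differ by one unit vector, so the increment of the
      affine function is a single coefficient.\<close>
    have GA: "G i - G (i - 1) = A (\<delta> i)" if "i \<in> {1..n}" for i
    proof -
      obtain m where m: "i = Suc m" using \<open>i \<in> {1..n}\<close> by (cases i) auto
      have di: "\<delta> i \<in> {1..n}" using permutes_in_image[OF d] that by blast
      have "real_of_int (q i k) = real_of_int (q (i-1) k) + of_bool (k = \<delta> i)" for k
        using permutes_image_atMost_Suc[OF d, of m] by (auto simp: q_def shift_def m)
      then have "G i - G (i - 1) = (\<Sum>k=1..n. A k * of_bool (k = \<delta> i))"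
        by (simp add: G_def R distrib_left sum.distrib)
      also have "\<dots> = A (\<delta> i)"
        using di by (simp add: of_bool_def if_distrib cong: if_cong)
      finally show ?thesis .
    qed
    have "SEPI_rhs n f p' \<delta>' x - G 0 = (\<Sum>k=1..n. A k * (x k - real_of_int (p k)))"
      by (simp add: R G_def q0 right_diff_distrib sum_subtractf)
    also have "\<dots> = (\<Sum>i=1..n. A (\<delta> i) * r i)"
      using sum.permute[OF d, of "\<lambda>k. A k * (x k - real_of_int (p k))"] by (simp add: o_def r_def)
    also have "\<dots> = (\<Sum>i=1..n. (G i - G (i - 1)) * r i)"
      using GA by (intro sum.cong) auto
    finally have "SEPI_rhs n f p \<delta> x - SEPI_rhs n f p' \<delta>' x
        = D 0 + (\<Sum>i=1..n. (D i - D (i - 1)) * r i)"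
      unfolding SEPI_rhs_shift[OF d] D_def q0
      by (simp add: q_def r_def left_diff_distrib sum_subtractf)
    moreover have "\<dots> \<ge> 0" using D r01 rmono by (rule Abel_sum_nonneg)
    ultimately show ?thesis by linarith
  qed
  then show ?thesis
    using p d unfolding most_violated_def is_arg_max_def SEPI_index_def violation_def s
    by (auto simp: not_less)
qed

section \<open>Results and step counts of the program\<close>

lemma result_bind_timed [simp]: "result (bind_timed m g) = result (g (result m))"
  by (simp add: result_def bind_timed_def split: prod.split)

lemma steps_bind_timed [simp]: "steps (bind_timed m g) = steps m + steps (g (result m))"
  by (simp add: result_def steps_def bind_timed_def split: prod.split)

lemma result_simps [simp]:
  "result (ret v) = v" "result (step v) = v" "result (rd a i) = a i"
  "result (wr a i v) = a(i := v)" "result (new_array n a) = a"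
  by (simp_all add: result_def ret_def step_def rd_def wr_def new_array_def)

lemma steps_simps [simp]:
  "steps (ret v) = 0" "steps (step v) = 1" "steps (rd a i) = 1"
  "steps (wr a i v) = 1" "steps (new_array n a) = n + 1"
  by (simp_all add: steps_def ret_def step_def rd_def wr_def new_array_def)

text \<open>At a tight coordinate \<open>x i\<close> equals an integer bound, so the floor minus one
  is the \<open>x i - 1\<close> of the algorithm.\<close>

definition round_at :: "(nat \<Rightarrow> int extended) \<Rightarrow> (nat \<Rightarrow> real) \<Rightarrow> nat \<Rightarrow> int" where
  "round_at u x i = (if Fin (x i) = real_bound (u i) then \<lfloor>x i\<rfloor> - 1 else \<lfloor>x i\<rfloor>)"

lemma result_round_loop:
  "result (round_loop u x k p r) =
     (\<lambda>i. if i \<in> {1..k} then round_at u x i else p i,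
      \<lambda>i. if i \<in> {1..k} then x i - real_of_int (round_at u x i) else r i)"
  by (induction k arbitrary: p r)
     (auto simp: fun_eq_iff round_at_def)

text \<open>An iteration makes two reads, a comparison, a rounding, at most one decrement, a
  subtraction and two writes.\<close>

lemma steps_round_loop: "steps (round_loop u x k p r) \<le> 8 * k + 1"
proof (induction k arbitrary: p r)
  case (Suc k)
  have "steps (round_loop u x k p r) \<le> Suc (Suc (8 * k))" for p r
    using Suc.IH[of p r] by simp
  then show ?case using Suc.IH by auto
qed simp

section \<open>Correctness and cost of merge sort\<close>

lemma mset_merge: "mset (result (merge r xs ys)) = mset xs + mset ys"
  by (induction r xs ys rule: merge.induct) auto

lemma set_merge: "set (result (merge r xs ys)) = set xs \<union> set ys"
  using arg_cong[OF mset_merge, of set_mset] by simp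

lemma sorted_merge:
  assumes "sorted_wrt (\<lambda>i j. r i \<ge> r j) xs" "sorted_wrt (\<lambda>i j. r i \<ge> r j) ys"
  shows "sorted_wrt (\<lambda>i j. r i \<ge> r j) (result (merge r xs ys))"
  using assms by (induction r xs ys rule: merge.induct) (auto simp: set_merge)

text \<open>Each element moved costs two reads, a comparison and a list construction; the final step
  ends the recursion.\<close>

lemma steps_merge: "steps (merge r xs ys) \<le> 4 * (length xs + length ys) + 1"
  by (induction r xs ys rule: merge.induct) auto

lemma merge_sort_trivial [simp]:
  "merge_sort r i 0 = step []" "merge_sort r i (Suc 0) = step [i]"
  by (simp_all add: merge_sort.simps)

lemma mset_merge_sort: "mset (result (merge_sort r i k)) = mset [i..<i+k]"
proof (induction r i k rule: merge_sort.induct)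
  case (1 r i k)
  show ?case
  proof (cases "k \<le> 1")
    case True
    then consider "k = 0" | "k = 1" by linarith
    then show ?thesis by cases simp_all
  next
    case False
    have "[i..<i + k] = [i..<i + k div 2] @ [i + k div 2..<i + k]"
      using upt_add_eq_append[of i "i + k div 2" "k - k div 2"] by simp
    then show ?thesis using False 1 by (simp add: merge_sort.simps[of r i k] mset_merge)
  qed
qed

lemma length_merge_sort: "length (result (merge_sort r i k)) = k"
  using arg_cong[OF mset_merge_sort, of size] by simp

lemma sorted_merge_sort: "sorted_wrt (\<lambda>i j. r i \<ge> r j) (result (merge_sort r i k))"
proof (induction r i k rule: merge_sort.induct)
  case (1 r i k)
  then show ?case by (simp add: merge_sort.simps[of r i k] sorted_merge)
qed

text \<open>The exponent \<open>e\<close> bounds the recursion depth, and both halves have at most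
  \<open>2 ^ e\<close> elements even for odd \<open>k\<close>. Counting one extra step per call
  absorbs the constant of \<open>steps_merge\<close>, so each level adds exactly
  \<open>4 * k\<close>.\<close>

lemma steps_merge_sort:
  "1 \<le> k \<Longrightarrow> k \<le> 2 ^ e \<Longrightarrow> steps (merge_sort r i k) + 1 \<le> 4 * k * e + 2 * k"
proof (induction e arbitrary: i k)
  case 0
  then show ?case by (simp add: le_Suc_eq)
next
  case (Suc e)
  show ?case
  proof (cases "k = 1")
    case True
    then show ?thesis by simp
  next
    case False
    define a b where "a = k div 2" and "b = k - k div 2"
    have ab: "1 \<le> a" "1 \<le> b" "a \<le> 2 ^ e" "b \<le> 2 ^ e" "k = a + b"
      using Suc.prems False by (auto simp: a_def b_def)
    have "steps (merge r (result (merge_sort r i a)) (result (merge_sort r (i + a) b))) \<le> 4 * k + 1"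
      using steps_merge[of r "result (merge_sort r i a)" "result (merge_sort r (i + a) b)"]
      by (simp add: length_merge_sort ab)
    moreover have "steps (merge_sort r i a) + 1 \<le> 4 * a * e + 2 * a"
      "steps (merge_sort r (i + a) b) + 1 \<le> 4 * b * e + 2 * b"
      using Suc.IH ab by auto
    moreover have "steps (merge_sort r i k) = steps (merge_sort r i a) + steps (merge_sort r (i + a) b)
        + steps (merge r (result (merge_sort r i a)) (result (merge_sort r (i + a) b)))"
      using Suc.prems False by (simp add: merge_sort.simps[of r i k] a_def b_def)
    ultimately show ?thesis by (simp add: ab(5) algebra_simps)
  qed
qed

section \<open>The sorted list as a permutation array\<close>

lemma result_store_list:
  "result (store_list xs i d) = (\<lambda>j. if j \<in> {i..<i + length xs} then xs ! (j - i) else d j)"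
  by (induction xs arbitrary: i d) (auto simp: fun_eq_iff nth_Cons' Suc_diff_le not_le)

lemma steps_store_list: "steps (store_list xs i d) = length xs + 1"
  by (induction xs arbitrary: i d) auto

text \<open>Distinct entries make the array injective on the finite set \<open>{1..n}\<close>, which
  it maps into itself, hence bijective there; the other cells keep the identity.\<close>

lemma store_list_permutes:
  assumes "mset xs = mset [1..<1 + n]"
  shows "result (store_list xs 1 (\<lambda>i. i)) permutes {1..n}"
proof -
  let ?d = "result (store_list xs 1 (\<lambda>i. i))"
  have len: "length xs = n" using arg_cong[OF assms, of size] by simp
  have st: "set xs = {1..n}" using arg_cong[OF assms, of set_mset] by auto
  have dist: "distinct xs" using mset_eq_imp_distinct_iff[OF assms] by simp
  have d: "?d j = xs ! (j - 1)" if "j \<in> {1..n}" for j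
    using that by (simp add: result_store_list len)
  have "?d ` {1..n} \<subseteq> {1..n}"
    using d len st by (force dest: nth_mem)
  moreover have "inj_on ?d {1..n}"
  proof (rule inj_onI)
    fix i j assume ij: "i \<in> {1..n}" "j \<in> {1..n}" "?d i = ?d j"
    then have "xs ! (i - 1) = xs ! (j - 1)" by (simp only: d)
    then have "i - 1 = j - 1"
      using ij(1,2) dist len by (subst (asm) nth_eq_iff_index_eq) auto
    then show "i = j" using ij(1,2) unfolding atLeastAtMost_iff by linarith
  qed
  ultimately have "bij_betw ?d {1..n} {1..n}"
    by (simp add: bij_betw_def endo_inj_surj)
  moreover have "?d j = j" if "j \<notin> {1..n}" for j
    using that by (auto simp: result_store_list len)
  ultimately show ?thesis by (rule bij_imp_permutes)
qed

section \<open>Coefficients of the output inequality\<close>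

lemma steps_coeff_loop: "steps (coeff_loop f d k i q v a b) = 9 * k + 1"
  by (induction k arbitrary: i q v a b) auto

text \<open>Loop invariant after \<open>m\<close> iterations: the affine function stored in
  \<open>a\<close> and \<open>b\<close>, plus the SEPI terms still to come, equals the final affine
  function. For \<open>m = 0\<close> and \<open>b = f p\<close> this is the whole SEPI.\<close>

lemma coeff_loop_correct:
  fixes p :: "nat \<Rightarrow> int"
  assumes d: "d permutes {1..n}"
  defines "S \<equiv> \<lambda>i. shift p (d ` {1..i})"
  assumes "m + k = n" "\<And>j. j \<notin> d ` {1..m} \<Longrightarrow> a j = 0"
    and "result (coeff_loop f d k (Suc m) (S m) (f (S m)) a b) = (a', b')"
  shows "b' + (\<Sum>i=1..n. a' i * y i) = b + (\<Sum>i=1..n. a i * y i)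
     + (\<Sum>i=Suc m..n. (f (S i) - f (S (i - 1))) * (y (d i) - real_of_int (p (d i))))"
  using assms(3-)
proof (induction k arbitrary: m a b)
  case 0
  then show ?case by simp
next
  case (Suc k)
  let ?j = "d (Suc m)" and ?s = "f (S (Suc m)) - f (S m)"
  note img = permutes_image_atMost_Suc[OF d, of m]
  have j: "?j \<in> {1..n}" using permutes_in_image[OF d, of "Suc m"] Suc.prems(1) by simp
  have read: "S m ?j = p ?j" using img by (simp add: S_def shift_def)
  have upd: "(S m)(?j := p ?j + 1) = S (Suc m)"
    unfolding S_def img(1) using img(2) by (auto simp: shift_def fun_eq_iff)
  have "result (coeff_loop f d k (Suc (Suc m)) (S (Suc m)) (f (S (Suc m)))
      (a(?j := ?s)) (b - ?s * real_of_int (p ?j))) = (a', b')"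
    using Suc.prems(3) by (simp add: read upd del: fun_upd_apply)
  moreover have "(a(?j := ?s)) i = 0" if "i \<notin> d ` {1..Suc m}" for i
    using that Suc.prems(2) img by auto
  ultimately have "b' + (\<Sum>i=1..n. a' i * y i)
     = b - ?s * real_of_int (p ?j) + (\<Sum>i=1..n. (a(?j := ?s)) i * y i)
     + (\<Sum>i=Suc (Suc m)..n. (f (S i) - f (S (i - 1))) * (y (d i) - real_of_int (p (d i))))"
    using Suc.prems(1) by (intro Suc.IH) (simp_all del: fun_upd_apply)
  moreover have "(\<Sum>i=1..n. (a(?j := ?s)) i * y i) = (\<Sum>i=1..n. a i * y i) + ?s * y ?j"
  proof -
    \<comment> \<open>The cell \<open>?j\<close> has not been written before, so overwriting its 0
      adds precisely the term \<open>?s * y ?j\<close>.\<close>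
    have "a ?j = 0" using Suc.prems(2) img by blast
    then have "(\<Sum>i=1..n. (a(?j := ?s)) i * y i)
        = (\<Sum>i=1..n. a i * y i + (if i = ?j then ?s * y ?j else 0))"
      by (intro sum.cong) auto
    then show ?thesis using j by (simp add: sum.distrib)
  qed
  moreover have "(\<Sum>i=Suc m..n. (f (S i) - f (S (i - 1))) * (y (d i) - real_of_int (p (d i))))
     = ?s * (y ?j - real_of_int (p ?j))
     + (\<Sum>i=Suc (Suc m)..n. (f (S i) - f (S (i - 1))) * (y (d i) - real_of_int (p (d i))))"
    using Suc.prems(1) by (subst sum.atLeast_Suc_atMost) auto
  ultimately show ?case by (simp add: algebra_simps)
qed

section \<open>The whole program\<close>

lemma result_fractional_greedy:
  assumes "result (fractional_greedy n u f (w, x)) = (p, \<delta>, a, b)"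
  shows "fractional_greedy_output n u x (p, \<delta>)"
    and "b + (\<Sum>i=1..n. a i * y i) = SEPI_rhs n f p \<delta> y"
proof -
  define r where "r i = (if i \<in> {1..n} then x i - real_of_int (round_at u x i) else 0)" for i
  define ds where "ds = result (merge_sort r 1 n)"
  have p: "p = (\<lambda>i. if i \<in> {1..n} then round_at u x i else 0)"
    and \<delta>: "\<delta> = result (store_list ds 1 (\<lambda>i. i))"
    and ab: "result (coeff_loop f \<delta> n 1 p (f p) (\<lambda>_. 0) (f p)) = (a, b)"
    using assms
    by (auto simp: fractional_greedy_def result_round_loop ds_def r_def [abs_def] split: prod.splits)
  have mset: "mset ds = mset [1..<1 + n]"
    unfolding ds_def by (rule mset_merge_sort)
  then have d: "\<delta> permutes {1..n}" unfolding \<delta> by (rule store_list_permutes)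
  have len: "length ds = n" unfolding ds_def by (rule length_merge_sort)
  have rp: "r (\<delta> i) = x (\<delta> i) - real_of_int (p (\<delta> i))" if "i \<in> {1..n}" for i
    using permutes_in_image[OF d, of i] that by (simp add: r_def p)
  have "r (\<delta> j) \<le> r (\<delta> i)" if "i \<in> {1..n}" "j \<in> {1..n}" "i \<le> j" for i j
  proof (cases "i = j")
    case False
    \<comment> \<open>List positions start at 0 and array cells at 1; \<open>sorted_wrt\<close>
      relates only distinct positions, hence the separate case \<open>i = j\<close>.\<close>
    then have "r (ds ! (j - 1)) \<le> r (ds ! (i - 1))"
      using sorted_wrt_nth_less[OF sorted_merge_sort[of r 1 n], of "i - 1" "j - 1"] that len
      by (auto simp: ds_def)
    then show ?thesis using that by (simp add: \<delta> result_store_list len)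
  qed simp
  then have "\<forall>i\<in>{1..n}. \<forall>j\<in>{1..n}. i \<le> j \<longrightarrow>
      x (\<delta> i) - real_of_int (p (\<delta> i)) \<ge> x (\<delta> j) - real_of_int (p (\<delta> j))"
    using rp by metis
  moreover have "if Fin (x i) = real_bound (u i) then real_of_int (p i) = x i - 1 else p i = \<lfloor>x i\<rfloor>"
    if "i \<in> {1..n}" for i
    using that by (cases "u i") (auto simp: p round_at_def)
  ultimately show "fractional_greedy_output n u x (p, \<delta>)"
    unfolding fractional_greedy_output_def using d by (simp add: vecs_def) (simp add: p)
  show "b + (\<Sum>i=1..n. a i * y i) = SEPI_rhs n f p \<delta> y"
    using coeff_loop_correct[OF d, of 0 n "\<lambda>_. 0" f p "f p" a b y] ab
    unfolding SEPI_rhs_shift[OF d] by simp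
qed

text \<open>The linear part 25 is 5 for the five new arrays, 8 for rounding, 2 from sorting, 1 for
  storing and 9 for the coefficients. The constants are covered by 20.\<close>

lemma steps_fractional_greedy:
  assumes "n \<le> 2 ^ e"
  shows "steps (fractional_greedy n u f (w, x)) \<le> 4 * n * e + 25 * n + 20"
proof -
  obtain p r where pr: "result (round_loop u x n (\<lambda>_. 0) (\<lambda>_. 0)) = (p, r)" by force
  \<comment> \<open>The added 1 covers \<open>n = 0\<close>, where sorting takes one step.\<close>
  have "steps (merge_sort r 1 n) \<le> 4 * n * e + 2 * n + 1"
  proof (cases "n = 0")
    case False
    then show ?thesis using steps_merge_sort[OF _ assms, of r 1] by simp
  qed simp
  then show ?thesis
    using steps_round_loop[of u x n "\<lambda>_. 0" "\<lambda>_. 0"]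
    by (simp add: fractional_greedy_def pr steps_store_list steps_coeff_loop length_merge_sort
        split: prod.split)
qed

theorem proposition3p3:
  shows "\<exists>T \<in> O(\<lambda>n::nat. real n * ln (real n)).
    \<forall>(n::nat) (l :: nat \<Rightarrow> int extended) (u :: nat \<Rightarrow> int extended) (f :: (nat \<Rightarrow> int) \<Rightarrow> real)
      (w::real) (x :: nat \<Rightarrow> real).
      Lnat_convex n l u f \<longrightarrow> x \<in> X_over n l u \<longrightarrow>
        (X_under n l u \<noteq> {} \<longrightarrow>
           (\<forall>s. fractional_greedy_output n u x s \<longrightarrow> most_violated n l u f w x s)) \<and>
        (\<forall>p \<delta> a b. result (fractional_greedy n u f (w, x)) = (p, \<delta>, a, b) \<longrightarrow>
           fractional_greedy_output n u x (p, \<delta>) \<and>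
           (X_under n l u \<noteq> {} \<longrightarrow> most_violated n l u f w x (p, \<delta>)) \<and>
           (\<forall>y. b + (\<Sum>i=1..n. a i * y i) = SEPI_rhs n f p \<delta> y)) \<and>
        real (steps (fractional_greedy n u f (w, x))) \<le> T n"
proof -
  \<comment> \<open>Rounding the binary logarithm up to the depth \<open>e\<close> costs at most 1,
    hence the summand \<open>+ 1\<close>. At \<open>n = 0\<close> the product with
    \<open>real n\<close> vanishes and \<open>T 0 = 20\<close>.\<close>
  define T where "T n = 4 * real n * (log 2 (real n) + 1) + 25 * real n + 20" for n
  have "T \<in> O(\<lambda>n::nat. real n * ln (real n))"
    unfolding T_def by real_asymp
  moreover have "real (steps (fractional_greedy n u f (w, x))) \<le> T n" for n u f w x
  proof (cases "n = 0")
    case True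
    then show ?thesis using steps_fractional_greedy[of n 0 u f w x] by (simp add: T_def)
  next
    case False
    define e where "e = nat \<lceil>log 2 (real n)\<rceil>"
    have log0: "log 2 (real n) \<ge> 0" using False by simp
    have "real n = 2 powr log 2 (real n)" using False by simp
    also have "\<dots> \<le> 2 powr real e" unfolding e_def by (intro powr_mono) linarith+
    finally have "n \<le> 2 ^ e" by (simp add: powr_realpow)
    then have "real (steps (fractional_greedy n u f (w, x))) \<le> 4 * real n * real e + 25 * real n + 20"
      using of_nat_mono[OF steps_fractional_greedy[of n e u f w x]] by simp
    moreover have "real e \<le> log 2 (real n) + 1" unfolding e_def using log0 by linarith
    then have "4 * real n * real e \<le> 4 * real n * (log 2 (real n) + 1)"
      by (intro mult_left_mono) auto
    ultimately show ?thesis by (simp add: T_def)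
  qed
  ultimately show ?thesis
    using fractional_greedy_output_most_violated result_fractional_greedy
    by (intro bexI[of _ T] allI impI conjI) simp_all
qed

end
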